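(* The twisting quantisation $\mathbb{C}_F[\mathbb{CM}^\#]$ is compatible with the $*$-algebra quotient $\mathbb{C}[\mathbb{CM}^\#]\to\mathbb{C}[S^4]$ if and only if $\theta_A=\theta_B=-\frac12\theta$. In this case \[ z^*=e^{\frac{\imath}{2}\theta}\tilde z,\qquad w^*=-e^{-\frac{\imath}{2}\theta}\tilde w . \]
   Context: $\mathbb{C}[\mathbb{CM}^\#]$ is the commutative unital $*$-algebra generated by the entries $P^\mu{}_\nu$ ($\mu,\nu=1,\dots,4$) with relations $P^2=P$, $\mathrm{Tr}\,P=2$ and $(P^\mu{}_\nu)^*=P^\nu{}_\mu$. Write \[ P=\begin{pmatrix} A & B \\ B^\dagger & D \end{pmatrix},\ B=\begin{pmatrix} z & \tilde w \\ w & \tilde z \end{pmatrix},\ A=\begin{pmatrix} a+\alpha_3 & \alpha \\ \alpha^* & a-\alpha_3 \end{pmatrix},\ D=\begin{pmatrix} 1-a+\delta_3 & \delta \\ \delta^* & 1-a-\delta_3 \end{pmatrix}. \] The classical $*$-algebra quotient $\mathbb{C}[S^4]$ is defined by the additional relations $z^*=\tilde z$, $w^*=-\tilde w$, $\alpha=\delta=0$, $\alpha_3=\delta_3=0$. Let $(\theta_{\mu\nu})$ be a real antisymmetric $4\times4$ matrix with all rows and columns summing to zero, and put \[ \theta_A=\theta_{12}+\theta_{23}+\theta_{31},\quad \theta_B=\theta_{23}+\theta_{34}+\theta_{42},\quad \theta=\theta_{13}-\theta_{23}+\theta_{24}-\theta_{14}. \] $\mathbb{C}[\mathbb{CM}^\#]$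 is graded by monomials in $t_1^{\pm1},\dots,t_4^{\pm1}$ modulo $t_1t_2t_3t_4=1$, with $P^\mu{}_\nu$ of weight $t_\mu t_\nu^{-1}$; $\mathbb{C}_F[\mathbb{CM}^\#]$ is the same vector space with the same $*$ and product $f\bullet g=F(\mathrm{wt}f,\mathrm{wt}g)fg$ on homogeneous elements, where $F(t^{\vec a},t^{\vec b})=e^{\imath\sum_{\mu,\nu} a_\mu\theta_{\mu\nu}b_\nu}$ and $t^{\vec a}=t_1^{a_1}\cdots t_4^{a_4}$. Its generators are $\hat P^\mu{}_\nu=e^{-\imath\theta_{\mu\nu}}P^\mu{}_\nu$, and the entries of $\hat P$ are, with hats omitted and reusing the names of the classical generators, denoted by \[ \hat P=\begin{pmatrix} a+\alpha_3 & \alpha & z & \tilde w \\ \alpha^* & a-\alpha_3 & w & \tilde z \\ z^* & w^* & 1-a+\delta_3 & \delta \\ \tilde w^* & \tilde z^* & \delta^* & 1-a-\delta_3 \end{pmatrix} \] (these are the $z,\tilde z,w,\tilde w$ in the displayed conclusion, which holds in the quotient). They satisfy $\hat P^i{}_j\bullet\hat P^k{}_l=e^{2\imath(\theta_{ik}-\theta_{jk}+\theta_{jl}-\theta_{il})}\hat P^k{}_l\bullet\hat P^i{}_j$. "Compatible" means that the classical relations defining the quotient, rewritten in terms of the generators of $\mathbb{C}_F[\mathbb{CM}^\#]$ (so $\alpha=\delta=0$, $\alpha_3=\delta_3=0$, and $z^*$, $w^*$ equal to $\tilde z$, $-\tilde w$ respectively up to twisting phase factors), define a $*$-algebra quotient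 of $\mathbb{C}_F[\mathbb{CM}^\#]$; in particular the commutation relations of $\mathbb{C}_F[\mathbb{CM}^\#]$ involving $z^*$ coincide with those involving $\tilde z$, and those involving $w^*$ coincide with those involving $\tilde w$.
   Formalization: "Only if" fails for one real θ (θ12=θ24=2π, θ14=−2π gives F=1 but θ_A≠θ_B), so the equivalence is stated for compatibility of the twists by sθ for all real s, and for a single twist when all |θ_μν|<π/2; "if" and the formulas for z*, w* hold for every θ. *)

theory Defs
  imports "HOL-Analysis.Analysis" "HOL-Library.Poly_Mapping"
begin

section \<open>The free commutative algebra on sixteen generators\<close>

text \<open>The index type is the four-element type \<open>4\<close>, whose elements are \<open>1, 2, 3\<close> and \<open>4 = 0\<close>.
  A monomial is an exponent function on pairs of indices, and a polynomial is a finitely supported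
  function from monomials to the complex numbers with convolution as product.\<close>

type_synonym mon = "(4 \<times> 4) \<Rightarrow>\<^sub>0 nat"
type_synonym fpoly = "mon \<Rightarrow>\<^sub>0 complex"

definition var :: "4 \<Rightarrow> 4 \<Rightarrow> fpoly" where
  "var \<mu> \<nu> = Poly_Mapping.single (Poly_Mapping.single (\<mu>, \<nu>) 1) 1"

definition const :: "complex \<Rightarrow> fpoly" where
  "const c = Poly_Mapping.single 0 c"

definition proj_rel :: "4 \<Rightarrow> 4 \<Rightarrow> fpoly" where
  "proj_rel \<mu> \<nu> = (\<Sum>\<kappa>\<in>UNIV. var \<mu> \<kappa> * var \<kappa> \<nu>) - var \<mu> \<nu>"

definition trace_rel :: fpoly where
  "trace_rel = (\<Sum>\<mu>\<in>UNIV. var \<mu> \<mu>) - 2"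

definition ccm_rels :: "fpoly set" where
  "ccm_rels = insert trace_rel {proj_rel \<mu> \<nu> |\<mu> \<nu>. True}"

text \<open>The span of a set in a commutative ring, as a module over itself, is the ideal it generates.\<close>

definition ccm_ideal :: "fpoly set" where
  "ccm_ideal = module.span (*) ccm_rels"

definition swap_mon :: "mon \<Rightarrow> mon" where
  "swap_mon m = Poly_Mapping.map_key prod.swap m"

text \<open>The conjugate-linear ring involution exchanging the variables with indices
  \<open>(\<mu>, \<nu>)\<close> and \<open>(\<nu>, \<mu>)\<close>.\<close>

definition star_poly :: "fpoly \<Rightarrow> fpoly" where
  "star_poly p = (\<Sum>m\<in>Poly_Mapping.keys p.
     Poly_Mapping.single (swap_mon m) (cnj (Poly_Mapping.lookup p m)))"

text \<open>The weight \<open>t\<^sub>1^a\<^sub>1 \<dots> t\<^sub>4^a\<^sub>4\<close> is represented by its exponent vector \<open>a\<close>. Exponents matter only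
  modulo the vector \<open>(1,1,1,1)\<close>; all monomials below have exponent vectors with coordinate sum
  zero, and two such vectors that agree modulo \<open>(1,1,1,1)\<close> are equal, so no quotient has to be
  taken.\<close>

definition mon_wt :: "mon \<Rightarrow> int^4" where
  "mon_wt m = (\<Sum>(\<mu>, \<nu>)\<in>UNIV.
     of_nat (Poly_Mapping.lookup m (\<mu>, \<nu>)) *s (axis \<mu> 1 - axis \<nu> 1))"

definition homog_poly :: "int^4 \<Rightarrow> fpoly \<Rightarrow> bool" where
  "homog_poly a p \<longleftrightarrow> (\<forall>m\<in>Poly_Mapping.keys p. mon_wt m = a)"

definition cocycle :: "real^4^4 \<Rightarrow> int^4 \<Rightarrow> int^4 \<Rightarrow> complex" where
  "cocycle \<theta> a b = exp (\<i> * complex_of_real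
     (\<Sum>\<mu>\<in>UNIV. \<Sum>\<nu>\<in>UNIV. of_int (a $ \<mu>) * \<theta> $ \<mu> $ \<nu> * of_int (b $ \<nu>)))"

text \<open>The bilinear extension of \<open>f \<bullet> g = F(wt f, wt g) f g\<close> from monomials to polynomials.\<close>

definition tw_poly :: "real^4^4 \<Rightarrow> fpoly \<Rightarrow> fpoly \<Rightarrow> fpoly" where
  "tw_poly \<theta> p q = (\<Sum>m\<in>Poly_Mapping.keys p. \<Sum>n\<in>Poly_Mapping.keys q.
     Poly_Mapping.single (m + n) (cocycle \<theta> (mon_wt m) (mon_wt n)
       * Poly_Mapping.lookup p m * Poly_Mapping.lookup q n))"

subsection \<open>Compatibility of these operations with the ideal\<close>

lemma module_times: "module ((*) :: 'a::comm_ring_1 \<Rightarrow> 'a \<Rightarrow> 'a)"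
  by standard (auto simp: algebra_simps)

lemma ccm_ideal_0: "0 \<in> ccm_ideal"
  and ccm_ideal_add: "p \<in> ccm_ideal \<Longrightarrow> q \<in> ccm_ideal \<Longrightarrow> p + q \<in> ccm_ideal"
  and ccm_ideal_diff: "p \<in> ccm_ideal \<Longrightarrow> q \<in> ccm_ideal \<Longrightarrow> p - q \<in> ccm_ideal"
  and ccm_ideal_uminus: "p \<in> ccm_ideal \<Longrightarrow> - p \<in> ccm_ideal"
  and ccm_ideal_mult: "p \<in> ccm_ideal \<Longrightarrow> r * p \<in> ccm_ideal"
  and ccm_ideal_base: "p \<in> ccm_rels \<Longrightarrow> p \<in> ccm_ideal"
  unfolding ccm_ideal_def
  by (fact module.span_zero[OF module_times] module.span_add[OF module_times]
    module.span_diff[OF module_times] module.span_neg[OF module_times]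
    module.span_scale[OF module_times] module.span_base[OF module_times])+

lemma ccm_ideal_mult': "p \<in> ccm_ideal \<Longrightarrow> p * r \<in> ccm_ideal"
  using ccm_ideal_mult[of p r] by (simp add: mult.commute)

lemma ccm_ideal_sum: "(\<And>x. x \<in> A \<Longrightarrow> f x \<in> ccm_ideal) \<Longrightarrow> sum f A \<in> ccm_ideal"
  by (induction A rule: infinite_finite_induct) (auto intro: ccm_ideal_0 ccm_ideal_add)

lemma ccm_ideal_induct [consumes 1, case_names base step]:
  assumes "p \<in> ccm_ideal" "h 0"
    and "\<And>c r q. r \<in> ccm_rels \<Longrightarrow> h q \<Longrightarrow> h (c * r + q)"
  shows "h p"
  by (rule module.span_induct_alt[OF module_times assms(1)[unfolded ccm_ideal_def], of h])
    (use assms(2,3) in auto)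

lemma poly_eq_sum_single:
  "p = (\<Sum>m\<in>Poly_Mapping.keys p. Poly_Mapping.single m (Poly_Mapping.lookup p m))"
  by (rule poly_mapping_eqI)
    (auto simp: lookup_sum lookup_single when_def in_keys_iff)

lemma swap_mon_add: "swap_mon (m + n) = swap_mon m + swap_mon n"
  unfolding swap_mon_def by (simp add: map_key_plus)

lemma swap_mon_0: "swap_mon 0 = 0"
  unfolding swap_mon_def by simp

lemma star_poly_0: "star_poly 0 = 0"
  by (simp add: star_poly_def)

lemma star_poly_add: "star_poly (p + q) = star_poly p + star_poly q"
  unfolding star_poly_def by (rule setsum_keys_plus_distrib) (auto simp: single_add)

lemma star_poly_uminus: "star_poly (- p) = - star_poly p"
  by (rule additive.minus[OF additive.intro[OF star_poly_add]])

lemma star_poly_diff: "star_poly (p - q) = star_poly p - star_poly q"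
  by (rule additive.diff[OF additive.intro[OF star_poly_add]])

lemma star_poly_sum: "star_poly (sum f A) = (\<Sum>x\<in>A. star_poly (f x))"
  by (induction A rule: infinite_finite_induct) (auto simp: star_poly_0 star_poly_add)

lemma star_poly_single:
  "star_poly (Poly_Mapping.single m c) = Poly_Mapping.single (swap_mon m) (cnj c)"
  by (auto simp: star_poly_def)

lemma star_poly_mult: "star_poly (p * q) = star_poly p * star_poly q"
proof -
  have "star_poly (p * q) = star_poly
      ((\<Sum>m\<in>Poly_Mapping.keys p. Poly_Mapping.single m (Poly_Mapping.lookup p m)) *
       (\<Sum>m\<in>Poly_Mapping.keys q. Poly_Mapping.single m (Poly_Mapping.lookup q m)))"
    by (simp flip: poly_eq_sum_single)
  also have "\<dots> = star_poly p * star_poly q"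
    by (simp add: sum_product mult_single star_poly_sum star_poly_single swap_mon_add
        star_poly_def[of p] star_poly_def[of q])
  finally show ?thesis .
qed

lemma star_poly_var: "star_poly (var \<mu> \<nu>) = var \<nu> \<mu>"
proof -
  have "swap_mon (Poly_Mapping.single (\<mu>, \<nu>) 1) = Poly_Mapping.single (\<nu>, \<mu>) 1"
    using map_key_single[of prod.swap "(\<nu>, \<mu>)" "1::nat"] by (simp add: swap_mon_def)
  then show ?thesis by (simp add: var_def star_poly_single)
qed

lemma star_poly_1: "star_poly 1 = 1"
  by (simp add: star_poly_single swap_mon_0 flip: single_one)

lemma star_poly_2: "star_poly 2 = 2"
  using star_poly_add[of 1 1] by (simp add: star_poly_1)

lemma star_poly_rels: "r \<in> ccm_rels \<Longrightarrow> star_poly r \<in> ccm_rels"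
proof -
  have "star_poly (proj_rel \<mu> \<nu>) = proj_rel \<nu> \<mu>" for \<mu> \<nu>
    by (simp add: proj_rel_def star_poly_diff star_poly_sum star_poly_mult star_poly_var mult.commute)
  moreover have "star_poly trace_rel = trace_rel"
    by (simp add: trace_rel_def star_poly_diff star_poly_sum star_poly_var star_poly_2)
  ultimately show "r \<in> ccm_rels \<Longrightarrow> star_poly r \<in> ccm_rels"
    by (auto simp: ccm_rels_def)
qed

lemma star_poly_ideal: "p \<in> ccm_ideal \<Longrightarrow> star_poly p \<in> ccm_ideal"
  by (induction rule: ccm_ideal_induct)
    (auto simp: star_poly_0 star_poly_add star_poly_mult
      intro: ccm_ideal_0 ccm_ideal_add ccm_ideal_mult ccm_ideal_base star_poly_rels)

lemma mon_wt_add: "mon_wt (m + n) = mon_wt m + mon_wt n"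
  unfolding mon_wt_def
  by (simp add: lookup_add case_prod_unfold vector_sadd_rdistrib flip: sum.distrib)
    (simp add: algebra_simps)

lemma mon_wt_0: "mon_wt 0 = 0"
  unfolding mon_wt_def by (simp add: case_prod_unfold)

lemma mon_wt_var: "mon_wt (Poly_Mapping.single (\<mu>, \<nu>) 1) = axis \<mu> 1 - axis \<nu> 1"
proof -
  have "mon_wt (Poly_Mapping.single (\<mu>, \<nu>) 1)
      = (\<Sum>x\<in>UNIV. if x = (\<mu>, \<nu>) then axis \<mu> 1 - axis \<nu> 1 else 0)"
    unfolding mon_wt_def
    by (rule sum.cong) (auto simp: lookup_single when_def vec_eq_iff split: if_splits)
  then show ?thesis by simp
qed

lemma homog_poly_mult: "homog_poly a p \<Longrightarrow> homog_poly b q \<Longrightarrow> homog_poly (a + b) (p * q)"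
  using keys_mult[of p q] by (fastforce simp: homog_poly_def mon_wt_add)

lemma homog_poly_sum: "(\<And>x. x \<in> A \<Longrightarrow> homog_poly a (f x)) \<Longrightarrow> homog_poly a (sum f A)"
  unfolding homog_poly_def
  by (induction A rule: infinite_finite_induct) (use keys_add in fastforce)+

lemma homog_poly_diff: "homog_poly a p \<Longrightarrow> homog_poly a q \<Longrightarrow> homog_poly a (p - q)"
  unfolding homog_poly_def by (fastforce simp: in_keys_iff lookup_minus)

lemma homog_poly_single: "homog_poly (mon_wt m) (Poly_Mapping.single m c)"
  by (auto simp: homog_poly_def)

lemma homog_poly_var: "homog_poly (axis \<mu> 1 - axis \<nu> 1) (var \<mu> \<nu>)"
  unfolding var_def using homog_poly_single[of "Poly_Mapping.single (\<mu>, \<nu>) 1" 1]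
  by (simp only: mon_wt_var)

lemma homog_poly_rels:
  assumes "r \<in> ccm_rels"
  obtains a where "homog_poly a r"
proof -
  have "homog_poly (axis \<mu> 1 - axis \<nu> 1) (proj_rel \<mu> \<nu>)" for \<mu> \<nu>
  proof -
    have "homog_poly (axis \<mu> 1 - axis \<nu> 1) (var \<mu> \<kappa> * var \<kappa> \<nu>)" for \<kappa>
      using homog_poly_mult[OF homog_poly_var[of \<mu> \<kappa>] homog_poly_var[of \<kappa> \<nu>]] by simp
    then show ?thesis
      unfolding proj_rel_def by (intro homog_poly_diff homog_poly_sum homog_poly_var) auto
  qed
  moreover have "homog_poly 0 trace_rel"
  proof -
    have "homog_poly 0 2"
      using homog_poly_single[of 0 2] by (simp add: mon_wt_0)
    moreover have "homog_poly 0 (var \<mu> \<mu>)" for \<mu>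
      using homog_poly_var[of \<mu> \<mu>] by simp
    ultimately show ?thesis
      unfolding trace_rel_def by (intro homog_poly_diff homog_poly_sum) auto
  qed
  ultimately show thesis
    using assms that by (auto simp: ccm_rels_def)
qed

lemma tw_poly_0: "tw_poly \<theta> 0 q = 0" "tw_poly \<theta> p 0 = 0"
  by (simp_all add: tw_poly_def)

lemma tw_poly_add_left: "tw_poly \<theta> (p + p') q = tw_poly \<theta> p q + tw_poly \<theta> p' q"
  unfolding tw_poly_def
  by (rule setsum_keys_plus_distrib) (auto simp: algebra_simps single_add sum.distrib)

lemma tw_poly_add_right: "tw_poly \<theta> p (q + q') = tw_poly \<theta> p q + tw_poly \<theta> p q'"
  unfolding tw_poly_def sum.distrib[symmetric]
  by (intro sum.cong refl setsum_keys_plus_distrib) (auto simp: algebra_simps single_add)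

lemma tw_poly_diff_left: "tw_poly \<theta> (p - p') q = tw_poly \<theta> p q - tw_poly \<theta> p' q"
  by (rule additive.diff[OF additive.intro[of "\<lambda>p. tw_poly \<theta> p q", OF tw_poly_add_left]])

lemma tw_poly_diff_right: "tw_poly \<theta> p (q - q') = tw_poly \<theta> p q - tw_poly \<theta> p q'"
  by (rule additive.diff[OF additive.intro[of "tw_poly \<theta> p", OF tw_poly_add_right]])

lemma tw_poly_sum_left: "tw_poly \<theta> (sum f A) q = (\<Sum>x\<in>A. tw_poly \<theta> (f x) q)"
  by (induction A rule: infinite_finite_induct) (auto simp: tw_poly_0 tw_poly_add_left)

lemma tw_poly_sum_right: "tw_poly \<theta> p (sum f A) = (\<Sum>x\<in>A. tw_poly \<theta> p (f x))"
  by (induction A rule: infinite_finite_induct) (auto simp: tw_poly_0 tw_poly_add_right)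

lemma tw_poly_homog:
  assumes "homog_poly a p" "homog_poly b q"
  shows "tw_poly \<theta> p q = const (cocycle \<theta> a b) * (p * q)"
proof -
  have "const (cocycle \<theta> a b) * (p * q) = const (cocycle \<theta> a b) *
      ((\<Sum>m\<in>Poly_Mapping.keys p. Poly_Mapping.single m (Poly_Mapping.lookup p m)) *
       (\<Sum>m\<in>Poly_Mapping.keys q. Poly_Mapping.single m (Poly_Mapping.lookup q m)))"
    by (simp flip: poly_eq_sum_single)
  also have "\<dots> = tw_poly \<theta> p q"
    unfolding tw_poly_def sum_product
    unfolding sum_distrib_left const_def mult_single add_0 mult.assoc
    by (intro sum.cong refl) (use assms in \<open>auto simp: homog_poly_def\<close>)
  finally show ?thesis ..
qed

lemma tw_poly_ideal:
  assumes "p \<in> ccm_ideal"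
  shows "tw_poly \<theta> p q \<in> ccm_ideal" "tw_poly \<theta> q p \<in> ccm_ideal"
proof -
  have *: "tw_poly \<theta> (c * r) q \<in> ccm_ideal \<and> tw_poly \<theta> q (c * r) \<in> ccm_ideal"
    if r: "r \<in> ccm_rels" for c r
  proof -
    obtain a where a: "homog_poly a r"
      using homog_poly_rels[OF r] .
    have h: "homog_poly (mon_wt m + a) (Poly_Mapping.single m x * r)" for m x
      by (intro homog_poly_mult homog_poly_single a)
    have "tw_poly \<theta> (Poly_Mapping.single m x * r) (Poly_Mapping.single n y) \<in> ccm_ideal
        \<and> tw_poly \<theta> (Poly_Mapping.single n y) (Poly_Mapping.single m x * r) \<in> ccm_ideal" for m x n y
      unfolding tw_poly_homog[OF h homog_poly_single] tw_poly_homog[OF homog_poly_single h]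
      by (intro conjI ccm_ideal_mult ccm_ideal_mult' ccm_ideal_base r)
    then have "tw_poly \<theta>
          ((\<Sum>m\<in>Poly_Mapping.keys c. Poly_Mapping.single m (Poly_Mapping.lookup c m)) * r)
          (\<Sum>m\<in>Poly_Mapping.keys q. Poly_Mapping.single m (Poly_Mapping.lookup q m)) \<in> ccm_ideal
        \<and> tw_poly \<theta> (\<Sum>m\<in>Poly_Mapping.keys q. Poly_Mapping.single m (Poly_Mapping.lookup q m))
          ((\<Sum>m\<in>Poly_Mapping.keys c. Poly_Mapping.single m (Poly_Mapping.lookup c m)) * r)
          \<in> ccm_ideal"
      by (auto simp: sum_distrib_right tw_poly_sum_left tw_poly_sum_right intro!: ccm_ideal_sum)
    then show ?thesis by (simp flip: poly_eq_sum_single)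
  qed
  from assms have "tw_poly \<theta> p q \<in> ccm_ideal \<and> tw_poly \<theta> q p \<in> ccm_ideal"
    by (induction rule: ccm_ideal_induct)
      (use * in \<open>auto simp: tw_poly_0 tw_poly_add_left tw_poly_add_right
        intro: ccm_ideal_0 ccm_ideal_add\<close>)
  then show "tw_poly \<theta> p q \<in> ccm_ideal" "tw_poly \<theta> q p \<in> ccm_ideal" by auto
qed

subsection \<open>Evaluation at a matrix\<close>

definition eval_poly :: "(4 \<times> 4 \<Rightarrow> complex) \<Rightarrow> fpoly \<Rightarrow> complex" where
  "eval_poly \<phi> p = (\<Sum>m\<in>Poly_Mapping.keys p.
     Poly_Mapping.lookup p m * (\<Prod>x\<in>UNIV. \<phi> x ^ Poly_Mapping.lookup m x))"

lemma eval_poly_0: "eval_poly \<phi> 0 = 0"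
  by (simp add: eval_poly_def)

lemma eval_poly_add: "eval_poly \<phi> (p + q) = eval_poly \<phi> p + eval_poly \<phi> q"
  unfolding eval_poly_def by (rule setsum_keys_plus_distrib) (auto simp: algebra_simps)

lemma eval_poly_diff: "eval_poly \<phi> (p - q) = eval_poly \<phi> p - eval_poly \<phi> q"
  using eval_poly_add[of \<phi> "p - q" q] by simp

lemma eval_poly_sum: "eval_poly \<phi> (sum f A) = (\<Sum>x\<in>A. eval_poly \<phi> (f x))"
  by (induction A rule: infinite_finite_induct) (auto simp: eval_poly_0 eval_poly_add)

lemma eval_poly_single:
  "eval_poly \<phi> (Poly_Mapping.single m c) = c * (\<Prod>x\<in>UNIV. \<phi> x ^ Poly_Mapping.lookup m x)"
  by (auto simp: eval_poly_def)

lemma eval_poly_mult: "eval_poly \<phi> (p * q) = eval_poly \<phi> p * eval_poly \<phi> q"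
proof -
  have "eval_poly \<phi> (p * q) = eval_poly \<phi>
      ((\<Sum>m\<in>Poly_Mapping.keys p. Poly_Mapping.single m (Poly_Mapping.lookup p m)) *
       (\<Sum>m\<in>Poly_Mapping.keys q. Poly_Mapping.single m (Poly_Mapping.lookup q m)))"
    by (simp flip: poly_eq_sum_single)
  also have "\<dots> = eval_poly \<phi> p * eval_poly \<phi> q"
    by (simp add: sum_product mult_single eval_poly_sum eval_poly_single lookup_add power_add
        prod.distrib eval_poly_def[of _ p] eval_poly_def[of _ q] mult_ac)
  finally show ?thesis .
qed

lemma eval_poly_1: "eval_poly \<phi> 1 = 1"
  by (simp add: eval_poly_single flip: single_one)

lemma eval_poly_2: "eval_poly \<phi> 2 = 2"
  using eval_poly_add[of \<phi> 1 1] by (simp add: eval_poly_1)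

lemma eval_poly_var: "eval_poly \<phi> (var \<mu> \<nu>) = \<phi> (\<mu>, \<nu>)"
proof -
  have "(\<Prod>x\<in>UNIV. \<phi> x ^ Poly_Mapping.lookup (Poly_Mapping.single (\<mu>, \<nu>) 1) x)
      = (\<Prod>x\<in>UNIV. if x = (\<mu>, \<nu>) then \<phi> x else 1)"
    by (rule prod.cong) (auto simp: lookup_single when_def)
  then show ?thesis by (simp add: var_def eval_poly_single)
qed

lemma eval_poly_ideal:
  assumes "p \<in> ccm_ideal"
    and "\<And>\<mu> \<nu>. (\<Sum>\<kappa>\<in>UNIV. \<phi> (\<mu>, \<kappa>) * \<phi> (\<kappa>, \<nu>)) = \<phi> (\<mu>, \<nu>)"
    and "(\<Sum>\<mu>\<in>UNIV. \<phi> (\<mu>, \<mu>)) = 2"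
  shows "eval_poly \<phi> p = 0"
proof -
  have *: "eval_poly \<phi> r = 0" if "r \<in> ccm_rels" for r
    using that assms(2,3)
    by (auto simp: ccm_rels_def trace_rel_def proj_rel_def eval_poly_diff eval_poly_sum
        eval_poly_mult eval_poly_var eval_poly_2)
  show ?thesis
    using assms(1)
    by (induction rule: ccm_ideal_induct) (auto simp: * eval_poly_0 eval_poly_add eval_poly_mult)
qed

lemma one_notin_ccm_ideal: "1 \<notin> ccm_ideal"
proof
  let ?\<phi> = "\<lambda>(\<mu>::4, \<nu>). if \<mu> = \<nu> \<and> (\<mu> = 1 \<or> \<mu> = 2) then 1 else 0 :: complex"
  assume "1 \<in> ccm_ideal"
  then have "eval_poly ?\<phi> 1 = 0"
    by (rule eval_poly_ideal) (auto simp: sum_4)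
  then show False by (simp add: eval_poly_1)
qed

section \<open>The *-algebra \<open>\<complex>[CM\<^sup>#]\<close>\<close>

definition ccm_rel :: "fpoly \<Rightarrow> fpoly \<Rightarrow> bool" where
  "ccm_rel p q \<longleftrightarrow> p - q \<in> ccm_ideal"

quotient_type ccm = fpoly / ccm_rel
proof (rule equivpI)
  show "reflp ccm_rel" by (auto simp: ccm_rel_def reflp_def ccm_ideal_0)
  show "symp ccm_rel"
    by (auto simp: ccm_rel_def symp_def) (use ccm_ideal_uminus in fastforce)
  show "transp ccm_rel"
    by (auto simp: ccm_rel_def transp_def) (use ccm_ideal_add in fastforce)
qed

instantiation ccm :: comm_ring_1
begin

lift_definition zero_ccm :: ccm is 0 .

lift_definition one_ccm :: ccm is 1 .

lift_definition plus_ccm :: "ccm \<Rightarrow> ccm \<Rightarrow> ccm" is "(+)"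
  unfolding ccm_rel_def add_diff_add by (rule ccm_ideal_add)

lift_definition uminus_ccm :: "ccm \<Rightarrow> ccm" is uminus
  unfolding ccm_rel_def minus_diff_minus by (rule ccm_ideal_uminus)

lift_definition minus_ccm :: "ccm \<Rightarrow> ccm \<Rightarrow> ccm" is "(-)"
proof -
  fix p p' q q' assume *: "ccm_rel p p'" "ccm_rel q q'"
  have "p - q - (p' - q') = (p - p') - (q - q')" by simp
  then show "ccm_rel (p - q) (p' - q')"
    using * unfolding ccm_rel_def by (simp only: ccm_ideal_diff)
qed

lift_definition times_ccm :: "ccm \<Rightarrow> ccm \<Rightarrow> ccm" is "(*)"
proof -
  fix p p' q q' assume *: "ccm_rel p p'" "ccm_rel q q'"
  have "p * q - p' * q' = q * (p - p') + p' * (q - q')" by (simp add: algebra_simps)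
  then show "ccm_rel (p * q) (p' * q')"
    using * unfolding ccm_rel_def by (simp add: ccm_ideal_add ccm_ideal_mult)
qed

instance
proof
  show "(0::ccm) \<noteq> 1"
  proof transfer
    show "\<not> ccm_rel 0 1"
      using ccm_ideal_uminus[of "- 1"] one_notin_ccm_ideal by (auto simp: ccm_rel_def)
  qed
qed (transfer, simp add: ccm_rel_def algebra_simps ccm_ideal_0)+

end

lift_definition cscale :: "complex \<Rightarrow> ccm \<Rightarrow> ccm" (infixr \<open>*\<^sub>C\<close> 75) is "\<lambda>c p. const c * p"
  unfolding ccm_rel_def right_diff_distrib[symmetric] by (rule ccm_ideal_mult)

lift_definition star :: "ccm \<Rightarrow> ccm" is star_poly
  unfolding ccm_rel_def star_poly_diff[symmetric] by (rule star_poly_ideal)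

lift_definition Pgen :: "4 \<Rightarrow> 4 \<Rightarrow> ccm" is var .

definition homogeneous :: "int^4 \<Rightarrow> ccm \<Rightarrow> bool" where
  "homogeneous a f \<longleftrightarrow> (\<exists>p. homog_poly a p \<and> f = abs_ccm p)"

section \<open>The cocycle twist \<open>\<complex>\<^sub>F[CM\<^sup>#]\<close>\<close>

text \<open>\<open>\<complex>\<^sub>F[CM\<^sup>#]\<close> has the same underlying vector space and the same star, so it is represented
  by the type \<^typ>\<open>ccm\<close> with the product \<open>twprod \<theta>\<close>.\<close>

lift_definition twprod :: "real^4^4 \<Rightarrow> ccm \<Rightarrow> ccm \<Rightarrow> ccm" is tw_poly
proof -
  fix \<theta> p p' q q' assume *: "ccm_rel p p'" "ccm_rel q q'"
  have "tw_poly \<theta> p q - tw_poly \<theta> p' q' = tw_poly \<theta> (p - p') q + tw_poly \<theta> p' (q - q')"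
    by (simp add: tw_poly_diff_left tw_poly_diff_right)
  then show "ccm_rel (tw_poly \<theta> p q) (tw_poly \<theta> p' q')"
    using * unfolding ccm_rel_def by (simp add: ccm_ideal_add tw_poly_ideal)
qed

lemma twprod_homogeneous:
  assumes "homogeneous a f" "homogeneous b g"
  shows "twprod \<theta> f g = cocycle \<theta> a b *\<^sub>C (f * g)"
proof -
  obtain p q where "homog_poly a p" "f = abs_ccm p" "homog_poly b q" "g = abs_ccm q"
    using assms unfolding homogeneous_def by blast
  then show ?thesis
    by (simp add: twprod.abs_eq times_ccm.abs_eq cscale.abs_eq tw_poly_homog)
qed

lemma homogeneous_Pgen: "homogeneous (axis \<mu> 1 - axis \<nu> 1) (Pgen \<mu> \<nu>)"
  unfolding homogeneous_def Pgen_def using homog_poly_var by auto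

lemma star_Pgen: "star (Pgen \<mu> \<nu>) = Pgen \<nu> \<mu>"
  by transfer (simp add: star_poly_var ccm_rel_def ccm_ideal_0)

definition Phat :: "real^4^4 \<Rightarrow> 4 \<Rightarrow> 4 \<Rightarrow> ccm" where
  "Phat \<theta> \<mu> \<nu> = exp (- \<i> * complex_of_real (\<theta> $ \<mu> $ \<nu>)) *\<^sub>C Pgen \<mu> \<nu>"

text \<open>The entries of the block form of a matrix \<open>M\<close> of algebra elements, applied below both to the
  classical generators and to the twisted ones.\<close>

definition ent_z :: "(4 \<Rightarrow> 4 \<Rightarrow> ccm) \<Rightarrow> ccm" where "ent_z M = M 1 3"
definition ent_zt :: "(4 \<Rightarrow> 4 \<Rightarrow> ccm) \<Rightarrow> ccm" where "ent_zt M = M 2 4"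
definition ent_w :: "(4 \<Rightarrow> 4 \<Rightarrow> ccm) \<Rightarrow> ccm" where "ent_w M = M 2 3"
definition ent_wt :: "(4 \<Rightarrow> 4 \<Rightarrow> ccm) \<Rightarrow> ccm" where "ent_wt M = M 1 4"
definition ent_\<alpha> :: "(4 \<Rightarrow> 4 \<Rightarrow> ccm) \<Rightarrow> ccm" where "ent_\<alpha> M = M 1 2"
definition ent_\<delta> :: "(4 \<Rightarrow> 4 \<Rightarrow> ccm) \<Rightarrow> ccm" where "ent_\<delta> M = M 3 4"
definition ent_\<alpha>3 :: "(4 \<Rightarrow> 4 \<Rightarrow> ccm) \<Rightarrow> ccm" where "ent_\<alpha>3 M = (1/2) *\<^sub>C (M 1 1 - M 2 2)"
definition ent_\<delta>3 :: "(4 \<Rightarrow> 4 \<Rightarrow> ccm) \<Rightarrow> ccm" where "ent_\<delta>3 M = (1/2) *\<^sub>C (M 3 3 - M 4 4)"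

definition sphere_rels :: "(4 \<Rightarrow> 4 \<Rightarrow> ccm) \<Rightarrow> ccm set" where
  "sphere_rels M = {star (ent_z M) - ent_zt M, star (ent_w M) + ent_wt M,
     ent_\<alpha> M, ent_\<delta> M, ent_\<alpha>3 M, ent_\<delta>3 M}"

text \<open>The two-sided *-ideal generated by \<open>R\<close> for the product \<open>mul\<close>. Closure under complex scalars
  follows from closure under products, as scalar multiples of the unit act by scalars.\<close>

inductive_set star_ideal :: "(ccm \<Rightarrow> ccm \<Rightarrow> ccm) \<Rightarrow> ccm set \<Rightarrow> ccm set"
  for mul :: "ccm \<Rightarrow> ccm \<Rightarrow> ccm" and R :: "ccm set" where
  gen: "r \<in> R \<Longrightarrow> r \<in> star_ideal mul R"
| zero: "0 \<in> star_ideal mul R"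
| add: "f \<in> star_ideal mul R \<Longrightarrow> g \<in> star_ideal mul R \<Longrightarrow> f + g \<in> star_ideal mul R"
| left: "f \<in> star_ideal mul R \<Longrightarrow> mul h f \<in> star_ideal mul R"
| right: "f \<in> star_ideal mul R \<Longrightarrow> mul f h \<in> star_ideal mul R"
| star: "f \<in> star_ideal mul R \<Longrightarrow> star f \<in> star_ideal mul R"

text \<open>The kernel of the classical quotient map \<open>\<complex>[CM\<^sup>#] \<rightarrow> \<complex>[S\<^sup>4]\<close>.\<close>

definition sphere_ideal :: "ccm set" where
  "sphere_ideal = star_ideal (*) (sphere_rels Pgen)"

text \<open>The classical relations are rewritten in terms of the twisted generators by substituting
  \<open>exp (\<i> \<theta>\<^sub>\<mu>\<^sub>\<nu>) Phat \<mu> \<nu>\<close> for \<open>Pgen \<mu> \<nu>\<close>. In terms of the entries of \<open>Phat\<close> this puts phase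
  factors between \<open>star ent_z\<close> and \<open>ent_zt\<close> and between \<open>star ent_w\<close> and \<open>ent_wt\<close>.\<close>

definition tw_sphere_rels :: "real^4^4 \<Rightarrow> ccm set" where
  "tw_sphere_rels \<theta> =
     sphere_rels (\<lambda>\<mu> \<nu>. exp (\<i> * complex_of_real (\<theta> $ \<mu> $ \<nu>)) *\<^sub>C Phat \<theta> \<mu> \<nu>)"

definition tw_sphere_ideal :: "real^4^4 \<Rightarrow> ccm set" where
  "tw_sphere_ideal \<theta> = star_ideal (twprod \<theta>) (tw_sphere_rels \<theta>)"

definition tw_sphere_eq :: "real^4^4 \<Rightarrow> ccm \<Rightarrow> ccm \<Rightarrow> bool" where
  "tw_sphere_eq \<theta> f g \<longleftrightarrow> f - g \<in> tw_sphere_ideal \<theta>"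

text \<open>Any set of relations generates some *-ideal of the twisted algebra, possibly a far too
  large one. The twist is compatible with \<open>\<complex>[CM\<^sup>#] \<rightarrow> \<complex>[S\<^sup>4]\<close> if the rewritten relations generate
  exactly the kernel of this map, so that the twisted *-algebra structure
  descends to the vector space \<open>\<complex>[S\<^sup>4]\<close>.\<close>

definition compatible :: "real^4^4 \<Rightarrow> bool" where
  "compatible \<theta> \<longleftrightarrow> tw_sphere_ideal \<theta> = sphere_ideal"

text \<open>For a single numerical matrix, compatibility depends on \<open>\<theta>\<close> only through the phases
  \<open>exp (\<i> \<theta>\<^sub>\<mu>\<^sub>\<nu>)\<close>, and so cannot detect a linear identity between its entries (it holds for
  instance whenever all entries are multiples of \<open>2\<pi>\<close>). Compatibility of the quantisation,
  with \<open>\<theta>\<close> as its matrix of deformation parameters, is compatibility along the whole family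
  of twists by \<open>s\<theta>\<close> with \<open>s\<close> real.\<close>

definition compatible_quantisation :: "real^4^4 \<Rightarrow> bool" where
  "compatible_quantisation \<theta> \<longleftrightarrow> (\<forall>s::real. compatible (s *\<^sub>R \<theta>))"

definition \<theta>A :: "real^4^4 \<Rightarrow> real" where "\<theta>A \<theta> = \<theta> $ 1 $ 2 + \<theta> $ 2 $ 3 + \<theta> $ 3 $ 1"
definition \<theta>B :: "real^4^4 \<Rightarrow> real" where "\<theta>B \<theta> = \<theta> $ 2 $ 3 + \<theta> $ 3 $ 4 + \<theta> $ 4 $ 2"
definition \<theta>0 :: "real^4^4 \<Rightarrow> real" where
  "\<theta>0 \<theta> = \<theta> $ 1 $ 3 - \<theta> $ 2 $ 3 + \<theta> $ 2 $ 4 - \<theta> $ 1 $ 4"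

end

theory Submission
  imports Defs
begin

text \<open>Undoing the phases in the twisted generators turns the rewritten relations back into the
  classical ones, so the question is when the two products generate the same *-ideal from them.
  The two terms of \<open>z* - zt\<close>, and likewise of \<open>w* + wt\<close>, have weights differing by
  \<open>d = (1,1,-1,-1)\<close>. If the cocycle is trivial on \<open>d\<close>, every relation is multiplied by a homogeneous
  element in the twisted algebra as in the classical one up to a single phase, and both *-ideals
  are the classical ideal generated by the relations and their stars. The condition on \<open>\<theta>\<close> says
  precisely that \<open>d\<close> lies in the kernel of \<open>\<theta>\<close>. Conversely, twisted products of \<open>z* - zt\<close> with
  \<open>z\<close> and \<open>w\<close>, evaluated at a point of the sphere with \<open>z\<close> and \<open>w\<close> nonzero, force \<open>F\<close> to be \<open>1\<close>
  on \<open>d\<close> and the weights of \<open>z\<close> and \<open>w\<close>; for small \<open>\<theta>\<close> the exponents themselves then vanish.\<close>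

section \<open>Scalars, star, grading and twisted product on the quotient algebra\<close>

lemma ccm_rel_refl: "ccm_rel p p"
  by (simp add: ccm_rel_def ccm_ideal_0)

lemma cscale_mult_left: "(c *\<^sub>C f) * g = c *\<^sub>C (f * g)"
  by transfer (simp add: ccm_rel_refl mult.assoc)

lemma cscale_add_right: "c *\<^sub>C (f + g) = c *\<^sub>C f + c *\<^sub>C g"
  by transfer (simp add: ccm_rel_refl algebra_simps)

lemma cscale_diff_right: "c *\<^sub>C (f - g) = c *\<^sub>C f - c *\<^sub>C g"
  by transfer (simp add: ccm_rel_refl algebra_simps)

lemma cscale_minus_right: "c *\<^sub>C (- f) = - (c *\<^sub>C f)"
  by transfer (simp add: ccm_rel_refl)

lemma cscale_cscale: "c *\<^sub>C (d *\<^sub>C f) = (c * d) *\<^sub>C f"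
  by transfer (simp add: ccm_rel_refl const_def mult_single flip: mult.assoc)

lemma cscale_one: "1 *\<^sub>C f = f"
  by transfer (simp add: ccm_rel_refl const_def)

lemma cscale_minus_one: "(- 1) *\<^sub>C f = - f"
  by transfer (simp add: ccm_rel_refl const_def single_uminus)

lemma star_add: "star (f + g) = star f + star g"
  by transfer (simp add: ccm_rel_refl star_poly_add)

lemma star_diff: "star (f - g) = star f - star g"
  by transfer (simp add: ccm_rel_refl star_poly_diff)

lemma star_zero: "star 0 = 0"
  by transfer (simp add: ccm_rel_refl star_poly_0)

lemma star_mult: "star (f * g) = star f * star g"
  by transfer (simp add: ccm_rel_refl star_poly_mult)

lemma star_cscale: "star (c *\<^sub>C f) = cnj c *\<^sub>C star f"
  by transfer (simp add: ccm_rel_refl star_poly_mult const_def star_poly_single swap_mon_0)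

lemma swap_mon_swap_mon: "swap_mon (swap_mon m) = m"
  unfolding swap_mon_def by (rule poly_mapping_eqI) (simp add: map_key.rep_eq)

lemma star_poly_star_poly: "star_poly (star_poly p) = p"
proof -
  have "star_poly (star_poly p) =
      (\<Sum>m\<in>Poly_Mapping.keys p. Poly_Mapping.single m (Poly_Mapping.lookup p m))"
    by (simp add: star_poly_def[of p] star_poly_sum star_poly_single swap_mon_swap_mon)
  then show ?thesis by (simp flip: poly_eq_sum_single)
qed

lemma star_star: "star (star f) = f"
  by transfer (simp add: ccm_rel_refl star_poly_star_poly)

lemma twprod_0: "twprod \<theta> 0 g = 0" "twprod \<theta> f 0 = 0"
  by (transfer; simp add: ccm_rel_refl tw_poly_0)+

lemma twprod_add_left: "twprod \<theta> (f + f') g = twprod \<theta> f g + twprod \<theta> f' g"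
  by transfer (simp add: ccm_rel_refl tw_poly_add_left)

lemma twprod_add_right: "twprod \<theta> f (g + g') = twprod \<theta> f g + twprod \<theta> f g'"
  by transfer (simp add: ccm_rel_refl tw_poly_add_right)

lemma homog_poly_0: "homog_poly a 0"
  by (simp add: homog_poly_def)

lemma homogeneous_0: "homogeneous a 0"
  unfolding homogeneous_def zero_ccm_def using homog_poly_0 by auto

lemma homogeneous_mult: "homogeneous a f \<Longrightarrow> homogeneous b g \<Longrightarrow> homogeneous (a + b) (f * g)"
  unfolding homogeneous_def by (metis homog_poly_mult times_ccm.abs_eq)

lemma homogeneous_cscale:
  assumes "homogeneous a f"
  shows "homogeneous a (c *\<^sub>C f)"
proof -
  obtain p where p: "homog_poly a p" "f = abs_ccm p"
    using assms unfolding homogeneous_def by blast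
  have "homog_poly (0 + a) (const c * p)"
    using homog_poly_single[of 0 c] p(1) by (intro homog_poly_mult) (simp_all add: const_def mon_wt_0)
  then show ?thesis
    using p(2) unfolding homogeneous_def by (auto simp: cscale.abs_eq)
qed

lemma homogeneous_uminus: "homogeneous a f \<Longrightarrow> homogeneous a (- f)"
  using homogeneous_cscale[of a f "- 1"] by (simp add: cscale_minus_one)

text \<open>A polynomial is the sum of its monomials, whose classes are homogeneous. Zero falls
  under the first case, being homogeneous of every weight. The rule reduces bilinear statements to
  homogeneous factors.\<close>

lemma homogeneous_induct [case_names homogeneous add]:
  assumes hom: "\<And>a f. homogeneous a f \<Longrightarrow> Q f"
    and add: "\<And>f g. Q f \<Longrightarrow> Q g \<Longrightarrow> Q (f + g)"
  shows "Q h"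
proof -
  have Q_sum: "Q (abs_ccm (sum f A))" if "\<And>m. m \<in> A \<Longrightarrow> Q (abs_ccm (f m))" for f and A :: "mon set"
    using that
  proof (induction A rule: infinite_finite_induct)
    case (insert m A)
    then show ?case using add by (simp flip: plus_ccm.abs_eq)
  qed (use hom homogeneous_0 in \<open>auto simp flip: zero_ccm_def\<close>)
  obtain p where "h = abs_ccm p"
    by (metis Quotient3_abs_rep Quotient3_ccm)
  moreover have "Q (abs_ccm (\<Sum>m\<in>Poly_Mapping.keys p.
      Poly_Mapping.single m (Poly_Mapping.lookup p m)))"
    by (intro Q_sum hom) (auto simp: homogeneous_def intro: homog_poly_single)
  ultimately show ?thesis by (simp flip: poly_eq_sum_single)
qed

lemma cocycle_add_left: "cocycle \<theta> (a + a') b = cocycle \<theta> a b * cocycle \<theta> a' b"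
  unfolding cocycle_def by (simp add: algebra_simps sum.distrib flip: exp_add)

lemma cocycle_add_right: "cocycle \<theta> a (b + b') = cocycle \<theta> a b * cocycle \<theta> a b'"
  unfolding cocycle_def by (simp add: algebra_simps sum.distrib flip: exp_add)

lemma cocycle_nonzero: "cocycle \<theta> a b \<noteq> 0"
  by (simp add: cocycle_def)

lemma cocycle_zero: "cocycle 0 a b = 1"
  by (simp add: cocycle_def)

text \<open>With this, results on twisted ideals also cover the classical ideal, as the twist by the
  zero matrix.\<close>

lemma twprod_zero: "twprod 0 = (*)"
proof (intro ext)
  fix f g
  show "twprod 0 f g = f * g"
  proof (induction f rule: homogeneous_induct)
    case (homogeneous a f)
    then show ?case
      by (induction g rule: homogeneous_induct)
        (auto simp: twprod_homogeneous cocycle_zero cscale_one twprod_add_right algebra_simps)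
  qed (simp add: twprod_add_left algebra_simps)
qed

section \<open>Ideals generated by twist-homogeneous elements\<close>

text \<open>The sphere relations have at most two terms. The weights of the two summands may differ,
  as long as the cocycle cannot tell them apart in either argument.\<close>

definition twist_homogeneous :: "real^4^4 \<Rightarrow> ccm \<Rightarrow> bool" where
  "twist_homogeneous \<theta> r \<longleftrightarrow> (\<exists>a a' f g. homogeneous a f \<and> homogeneous a' g \<and> r = f + g
     \<and> (\<forall>b. cocycle \<theta> a b = cocycle \<theta> a' b \<and> cocycle \<theta> b a = cocycle \<theta> b a'))"

lemma twist_homogeneous_homogeneous: "homogeneous a f \<Longrightarrow> twist_homogeneous \<theta> f"
  unfolding twist_homogeneous_def using homogeneous_0 by (metis add.right_neutral)

lemma twist_homogeneous_add:
  assumes "homogeneous a f" "homogeneous (a + d) g"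
    and "\<And>b. cocycle \<theta> d b = 1" "\<And>b. cocycle \<theta> b d = 1"
  shows "twist_homogeneous \<theta> (f + g)"
  unfolding twist_homogeneous_def
  by (rule exI[of _ a], rule exI[of _ "a + d"])
    (use assms in \<open>auto simp: cocycle_add_left cocycle_add_right\<close>)

lemma twist_homogeneous_mult:
  assumes "homogeneous c h" "twist_homogeneous \<theta> r"
  shows "twist_homogeneous \<theta> (h * r)"
proof -
  obtain a a' f g where *: "homogeneous a f" "homogeneous a' g" "r = f + g"
    "\<And>b. cocycle \<theta> a b = cocycle \<theta> a' b" "\<And>b. cocycle \<theta> b a = cocycle \<theta> b a'"
    using assms(2) unfolding twist_homogeneous_def by blast
  show ?thesis
    unfolding twist_homogeneous_def
    by (rule exI[of _ "c + a"], rule exI[of _ "c + a'"], rule exI[of _ "h * f"],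
        rule exI[of _ "h * g"])
      (use assms(1) * in \<open>auto simp: cocycle_add_left cocycle_add_right distrib_left
        intro: homogeneous_mult\<close>)
qed

text \<open>The cocycle has the same value on both summands of \<open>r\<close>, so it comes out as
  a single phase. As \<open>k\<close> is independent of \<open>c\<close>, a suitable
  \<open>c\<close> can later cancel it.\<close>

lemma twprod_twist_homogeneous:
  assumes "homogeneous b h" "twist_homogeneous \<theta> r"
  obtains k l where "k \<noteq> 0" "l \<noteq> 0"
    "\<And>c. twprod \<theta> (c *\<^sub>C h) r = (k * c) *\<^sub>C (h * r)" "twprod \<theta> r h = l *\<^sub>C (h * r)"
proof -
  obtain a a' f g where *: "homogeneous a f" "homogeneous a' g" "r = f + g"
    "\<And>b. cocycle \<theta> a b = cocycle \<theta> a' b" "\<And>b. cocycle \<theta> b a = cocycle \<theta> b a'"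
    using assms(2) unfolding twist_homogeneous_def by blast
  show thesis
  proof (rule that)
    show "twprod \<theta> (c *\<^sub>C h) r = (cocycle \<theta> b a * c) *\<^sub>C (h * r)" for c
      using *(1,2) homogeneous_cscale[OF assms(1)]
      by (simp add: *(3) *(5)[symmetric] twprod_add_right twprod_homogeneous[of b _ a]
          twprod_homogeneous[of b _ a'] cscale_mult_left cscale_cscale distrib_left cscale_add_right)
    show "twprod \<theta> r h = cocycle \<theta> a b *\<^sub>C (h * r)"
      using *(1,2) assms(1)
      by (simp add: *(3) *(4)[symmetric] twprod_add_left twprod_homogeneous[of a _ b]
          twprod_homogeneous[of a' _ b] distrib_left cscale_add_right mult.commute[of h])
  qed (fact cocycle_nonzero)+
qed

lemmas span_0 = module.span_zero[OF module_times]
  and span_add = module.span_add[OF module_times]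
  and span_base = module.span_base[OF module_times]
  and span_mult = module.span_scale[OF module_times]

lemma span_cscale:
  assumes "f \<in> module.span (*) B"
  shows "c *\<^sub>C f \<in> module.span (*) B"
  using span_mult[OF assms, of "c *\<^sub>C 1"] by (simp add: cscale_mult_left)

text \<open>On these generators, twisted and classical multiplication by homogeneous elements differ
  by nonzero scalars only, so both produce the same ideal. The right-hand side is free of \<theta>,
  which makes different twists comparable.\<close>

lemma star_ideal_twprod:
  assumes hom: "\<And>r. r \<in> R \<union> star ` R \<Longrightarrow> twist_homogeneous \<theta> r"
  shows "star_ideal (twprod \<theta>) R = module.span (*) (R \<union> star ` R)" (is "?J = ?S")
proof (intro equalityI subsetI)
  have base: "twprod \<theta> h (c * r) \<in> ?S \<and> twprod \<theta> (c * r) h \<in> ?S" if r: "r \<in> R \<union> star ` R" for h c r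
  proof (induction c rule: homogeneous_induct)
    case (homogeneous a c)
    show ?case
    proof (induction h rule: homogeneous_induct)
      case (homogeneous b h)
      \<comment> \<open>The element \<open>c * r\<close> is again twist-homogeneous, so both twisted
        products with \<open>h\<close> are scalar multiples of the classical one.\<close>
      obtain k l where *: "\<And>x. twprod \<theta> (x *\<^sub>C h) (c * r) = (k * x) *\<^sub>C (h * (c * r))"
        "twprod \<theta> (c * r) h = l *\<^sub>C (h * (c * r))"
        using twprod_twist_homogeneous[OF homogeneous
            twist_homogeneous_mult[OF \<open>homogeneous a c\<close> hom[OF r]]] by metis
      have "x *\<^sub>C (h * (c * r)) \<in> ?S" for x
        by (intro span_cscale span_mult span_base r)
      then show ?case
        using *(1)[of 1] *(2) by (simp add: cscale_one)
    qed (auto simp: twprod_add_left twprod_add_right intro: span_add)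
  qed (auto simp: twprod_add_left twprod_add_right distrib_right intro: span_add)
  have tw: "twprod \<theta> h f \<in> ?S \<and> twprod \<theta> f h \<in> ?S" if "f \<in> ?S" for f h
    by (rule module.span_induct_alt[OF module_times that])
      (use base in \<open>auto simp: twprod_0 twprod_add_left twprod_add_right intro: span_0 span_add\<close>)
  have star_S: "star f \<in> ?S" if "f \<in> ?S" for f
  proof (rule module.span_induct_alt[OF module_times that])
    fix c r q assume r: "r \<in> R \<union> star ` R" and q: "star q \<in> ?S"
    from r have *: "star r \<in> R \<union> star ` R"
      by (auto simp: star_star)
    show "star (c * r + q) \<in> ?S"
      unfolding star_add star_mult by (intro span_add span_mult span_base * q)
  qed (simp add: star_zero span_0)
  show "f \<in> ?S" if "f \<in> ?J" for f
    using that
    by induction (use tw star_S in \<open>auto intro: span_0 span_add span_base\<close>)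
next
  have base: "c * r \<in> ?J" if r: "r \<in> R \<union> star ` R" for c r
  proof (induction c rule: homogeneous_induct)
    case (homogeneous a c)
    have "r \<in> ?J"
      using r by (auto intro: star_ideal.gen star_ideal.star)
    obtain k where "k \<noteq> 0" "\<And>x. twprod \<theta> (x *\<^sub>C c) r = (k * x) *\<^sub>C (c * r)"
      using twprod_twist_homogeneous[OF homogeneous hom[OF r]] by metis
    \<comment> \<open>Rescaling \<open>c\<close> by the inverse phase recovers the classical product
      from the twisted one.\<close>
    then have "c * r = twprod \<theta> ((1 / k) *\<^sub>C c) r"
      by (simp add: cscale_one)
    then show ?case
      using \<open>r \<in> ?J\<close> by (simp add: star_ideal.left)
  qed (auto simp: distrib_right intro: star_ideal.add)
  show "f \<in> ?J" if "f \<in> ?S" for f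
    by (rule module.span_induct_alt[OF module_times that])
      (use base in \<open>auto intro: star_ideal.zero star_ideal.add\<close>)
qed

section \<open>The relations of the sphere\<close>

lemma tw_sphere_rels_eq: "tw_sphere_rels \<theta> = sphere_rels Pgen"
  by (simp add: tw_sphere_rels_def Phat_def cscale_cscale cscale_one flip: exp_add)

text \<open>The vector d: the weight of \<open>Pgen 2 4\<close> minus that of
  \<open>Pgen 3 1\<close>, and equally the weight of \<open>Pgen 1 4\<close> minus that of
  \<open>Pgen 3 2\<close>.\<close>

definition sphere_wt :: "int^4" where
  "sphere_wt = axis 1 1 + axis 2 1 - axis 3 1 - axis 4 1"

lemma homogeneous_Pgen_0: "homogeneous 0 (Pgen \<mu> \<mu>)"
  using homogeneous_Pgen[of \<mu> \<mu>] by simp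

text \<open>Off-diagonal entries set to zero are homogeneous, and diagonal differences have weight
  zero. Only the relations for z and w and their stars mix two weights, which differ by
  \<open>sphere_wt\<close>.\<close>

lemma sphere_rels_twist_homogeneous:
  assumes d: "\<And>b. cocycle \<theta> sphere_wt b = 1" "\<And>b. cocycle \<theta> b sphere_wt = 1"
    and r: "r \<in> sphere_rels Pgen \<union> star ` sphere_rels Pgen"
  shows "twist_homogeneous \<theta> r"
proof -
  note add = twist_homogeneous_add[OF _ _ d]
  have gen: "twist_homogeneous \<theta> (Pgen \<mu> \<nu>)" for \<mu> \<nu>
    by (rule twist_homogeneous_homogeneous[OF homogeneous_Pgen])
  have diag: "twist_homogeneous \<theta> (c *\<^sub>C (Pgen \<mu> \<mu> - Pgen \<nu> \<nu>))" for c \<mu> \<nu>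
  proof -
    have "twist_homogeneous \<theta> (c *\<^sub>C Pgen \<mu> \<mu> + - (c *\<^sub>C Pgen \<nu> \<nu>))"
      by (rule twist_homogeneous_add[of 0 _ 0])
        (simp_all add: homogeneous_cscale homogeneous_uminus homogeneous_Pgen_0, simp_all add: cocycle_def)
    then show ?thesis
      using cscale_add_right[of c "Pgen \<mu> \<mu>" "- Pgen \<nu> \<nu>"] by (simp add: cscale_minus_right)
  qed
  have off: "twist_homogeneous \<theta> (Pgen \<mu> \<nu> + Pgen \<kappa> \<rho>)"
    "twist_homogeneous \<theta> (Pgen \<mu> \<nu> - Pgen \<kappa> \<rho>)"
    "twist_homogeneous \<theta> (Pgen \<kappa> \<rho> - Pgen \<mu> \<nu>)"
    if "axis \<kappa> 1 - axis \<rho> 1 = axis \<mu> 1 - axis \<nu> 1 + sphere_wt" for \<mu> \<nu> \<kappa> \<rho>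
  proof -
    have "homogeneous (axis \<mu> 1 - axis \<nu> 1 + sphere_wt) (Pgen \<kappa> \<rho>)"
      using homogeneous_Pgen[of \<kappa> \<rho>] that by simp
    then show "twist_homogeneous \<theta> (Pgen \<mu> \<nu> + Pgen \<kappa> \<rho>)"
      "twist_homogeneous \<theta> (Pgen \<mu> \<nu> - Pgen \<kappa> \<rho>)"
      "twist_homogeneous \<theta> (Pgen \<kappa> \<rho> - Pgen \<mu> \<nu>)"
      using add[OF homogeneous_Pgen, of \<mu> \<nu> "Pgen \<kappa> \<rho>"]
        add[OF homogeneous_Pgen, of \<mu> \<nu> "- Pgen \<kappa> \<rho>"]
        add[OF homogeneous_uminus[OF homogeneous_Pgen], of \<mu> \<nu> "Pgen \<kappa> \<rho>"]
      by (simp_all add: homogeneous_uminus)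
  qed
  have "twist_homogeneous \<theta> (Pgen 3 1 - Pgen 2 4)" "twist_homogeneous \<theta> (Pgen 3 2 + Pgen 1 4)"
    "twist_homogeneous \<theta> (Pgen 1 3 - Pgen 4 2)" "twist_homogeneous \<theta> (Pgen 2 3 + Pgen 4 1)"
    \<comment> \<open>In each instance the first two indices name the generator whose weight is
      larger by \<open>sphere_wt\<close>.\<close>
    using off(2)[of 2 4 3 1] off(1)[of 1 4 3 2] off(3)[of 1 3 4 2] off(1)[of 2 3 4 1]
    by (simp_all add: sphere_wt_def add.commute)
  then show ?thesis
    using r
    by (auto simp: sphere_rels_def ent_z_def ent_zt_def ent_w_def ent_wt_def ent_\<alpha>_def ent_\<delta>_def
        ent_\<alpha>3_def ent_\<delta>3_def star_Pgen star_add star_diff star_cscale gen diag)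
qed

text \<open>The same span arises for the zero twist, where it is the classical kernel. The explicit
  form is recorded because it gives closure under complex scalars.\<close>

lemma compatibleI:
  assumes "\<And>b. cocycle \<theta> sphere_wt b = 1" "\<And>b. cocycle \<theta> b sphere_wt = 1"
  shows "tw_sphere_ideal \<theta> = module.span (*) (sphere_rels Pgen \<union> star ` sphere_rels Pgen)"
    and "compatible \<theta>"
proof -
  show *: "tw_sphere_ideal \<theta> = module.span (*) (sphere_rels Pgen \<union> star ` sphere_rels Pgen)"
    unfolding tw_sphere_ideal_def tw_sphere_rels_eq
    by (rule star_ideal_twprod) (rule sphere_rels_twist_homogeneous[OF assms])
  have "sphere_ideal = module.span (*) (sphere_rels Pgen \<union> star ` sphere_rels Pgen)"
    using star_ideal_twprod[OF sphere_rels_twist_homogeneous[OF cocycle_zero cocycle_zero]]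
    by (simp add: sphere_ideal_def twprod_zero)
  with * show "compatible \<theta>"
    by (simp add: compatible_def)
qed

section \<open>A point of the sphere\<close>

text \<open>The rational point \<open>a = 1/2\<close>, \<open>z = zt = 3/10\<close>, \<open>w = - wt = 2/5\<close>.\<close>

definition sphere_point :: "4 \<times> 4 \<Rightarrow> complex" where
  "sphere_point = (\<lambda>(\<mu>, \<nu>). if \<mu> = \<nu> then 1/2
     else if (\<mu>, \<nu>) \<in> {(1,3), (3,1), (2,4), (4,2)} then 3/10
     else if (\<mu>, \<nu>) \<in> {(2,3), (3,2)} then 2/5
     else if (\<mu>, \<nu>) \<in> {(1,4), (4,1)} then - 2/5 else 0)"

lemma sphere_point_proj:
  "(\<Sum>\<kappa>\<in>UNIV. sphere_point (\<mu>, \<kappa>) * sphere_point (\<kappa>, \<nu>)) = sphere_point (\<mu>, \<nu>)"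
  using exhaust_4[of \<mu>] exhaust_4[of \<nu>]
  by (elim disjE; hypsubst; unfold sum_4 sphere_point_def; simp)

lemma sphere_point_trace: "(\<Sum>\<mu>\<in>UNIV. sphere_point (\<mu>, \<mu>)) = 2"
  by (simp add: sphere_point_def)

lift_definition eval_pt :: "ccm \<Rightarrow> complex" is "eval_poly sphere_point"
proof -
  fix p q assume "ccm_rel p q"
  then have "eval_poly sphere_point (p - q) = 0"
    unfolding ccm_rel_def by (rule eval_poly_ideal[OF _ sphere_point_proj sphere_point_trace])
  then show "eval_poly sphere_point p = eval_poly sphere_point q"
    by (simp add: eval_poly_diff)
qed

lemma eval_pt_0: "eval_pt 0 = 0"
  by transfer (rule eval_poly_0)

lemma eval_pt_add: "eval_pt (f + g) = eval_pt f + eval_pt g"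
  by transfer (rule eval_poly_add)

lemma eval_pt_diff: "eval_pt (f - g) = eval_pt f - eval_pt g"
  by transfer (rule eval_poly_diff)

lemma eval_pt_mult: "eval_pt (f * g) = eval_pt f * eval_pt g"
  by transfer (rule eval_poly_mult)

lemma eval_pt_cscale: "eval_pt (c *\<^sub>C f) = c * eval_pt f"
  by transfer (simp add: eval_poly_mult const_def eval_poly_single)

lemma eval_pt_Pgen: "eval_pt (Pgen \<mu> \<nu>) = sphere_point (\<mu>, \<nu>)"
  by transfer (rule eval_poly_var)

text \<open>The matrix of the point is real and symmetric, so exchanging indices amounts to
  conjugating values.\<close>

lemma eval_pt_star: "eval_pt (star f) = cnj (eval_pt f)"
proof transfer
  fix p
  have sym: "sphere_point (prod.swap x) = cnj (sphere_point x)" for x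
    using exhaust_4[of "fst x"] exhaust_4[of "snd x"]
    by (cases x, simp only: fst_conv snd_conv swap_simp)
      (elim disjE; hypsubst; simp add: sphere_point_def)
  have "(\<Prod>x\<in>UNIV. sphere_point x ^ Poly_Mapping.lookup (swap_mon m) x)
      = (\<Prod>x\<in>UNIV. sphere_point (prod.swap x) ^ Poly_Mapping.lookup m x)" for m
    by (rule prod.reindex_bij_witness[of _ prod.swap prod.swap])
      (auto simp: swap_mon_def map_key.rep_eq)
  then show "eval_poly sphere_point (star_poly p) = cnj (eval_poly sphere_point p)"
    by (simp add: star_poly_def eval_poly_sum eval_poly_single eval_poly_def[of _ p] sym)
qed

text \<open>Evaluation is a character compatible with the star, and the point satisfies the sphere
  relations.\<close>

lemma eval_pt_sphere_ideal: "f \<in> sphere_ideal \<Longrightarrow> eval_pt f = 0"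
  unfolding sphere_ideal_def
proof (induction rule: star_ideal.induct)
  case (gen r)
  then show ?case
    by (auto simp: sphere_rels_def ent_z_def ent_zt_def ent_w_def ent_wt_def ent_\<alpha>_def ent_\<delta>_def
        ent_\<alpha>3_def ent_\<delta>3_def star_Pgen eval_pt_add eval_pt_diff eval_pt_cscale eval_pt_Pgen
        sphere_point_def)
qed (simp_all add: eval_pt_0 eval_pt_add eval_pt_mult eval_pt_star)

text \<open>Under compatibility, the twisted product of z* - zt with \<open>Pgen \<mu> \<nu>\<close>
  vanishes at the point. There z* and zt have the same nonzero value, so their phases against
  \<open>Pgen \<mu> \<nu>\<close> agree. Their quotient is the cocycle on \<open>sphere_wt\<close>,
  since the cocycle is multiplicative in its first argument.\<close>

lemma compatible_imp_cocycle:
  assumes "compatible \<theta>" "sphere_point (\<mu>, \<nu>) \<noteq> 0"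
  shows "cocycle \<theta> sphere_wt (axis \<mu> 1 - axis \<nu> 1) = 1"
proof -
  let ?b = "axis \<mu> 1 - axis \<nu> 1 :: int^4"
  have "Pgen 3 1 - Pgen 2 4 \<in> sphere_rels Pgen"
    by (simp add: sphere_rels_def ent_z_def ent_zt_def star_Pgen)
  then have "twprod \<theta> (Pgen 3 1 - Pgen 2 4) (Pgen \<mu> \<nu>) \<in> tw_sphere_ideal \<theta>"
    unfolding tw_sphere_ideal_def tw_sphere_rels_eq by (intro star_ideal.right star_ideal.gen)
  then have "eval_pt (twprod \<theta> (Pgen 3 1 - Pgen 2 4) (Pgen \<mu> \<nu>)) = 0"
    using assms(1) eval_pt_sphere_ideal by (simp add: compatible_def)
  moreover have "twprod \<theta> (f - g) h = twprod \<theta> f h - twprod \<theta> g h" for f g h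
    by transfer (simp add: ccm_rel_refl tw_poly_diff_left)
  ultimately have "cocycle \<theta> (axis 3 1 - axis 1 1) ?b = cocycle \<theta> (axis 2 1 - axis 4 1) ?b"
    using assms(2)
    by (simp add: twprod_homogeneous[OF homogeneous_Pgen homogeneous_Pgen] eval_pt_diff
        eval_pt_cscale eval_pt_mult eval_pt_Pgen) (simp add: sphere_point_def)
  also have "axis 3 1 - axis 1 1 = (axis 2 1 - axis 4 1) - (sphere_wt :: int^4)"
    by (simp add: sphere_wt_def)
  finally show ?thesis
    using cocycle_add_left[of \<theta> "axis 2 1 - axis 4 1 - sphere_wt" sphere_wt ?b]
    by (simp add: cocycle_nonzero)
qed

lemma exp_ii_eq_1_imp_zero:
  assumes "exp (\<i> * complex_of_real x) = 1" "\<bar>x\<bar> < 2 * pi"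
  shows "x = 0"
proof -
  obtain n :: int where n: "x = of_int (2 * n) * pi"
    using assms(1) unfolding exp_eq_1 by auto
  have "\<bar>real_of_int n\<bar> < 1"
    using assms(2) by (simp add: n abs_mult)
  then show ?thesis
    by (simp add: n)
qed

section \<open>The condition on the deformation parameters\<close>

text \<open>Three free parameters remain, the entries 12, 13 and 23. The equations serve as rewrite
  rules that eliminate all others.\<close>

lemma deformation_matrix:
  fixes \<theta> :: "real^4^4"
  assumes "\<forall>\<mu> \<nu>. \<theta> $ \<mu> $ \<nu> = - \<theta> $ \<nu> $ \<mu>"
    and "\<forall>\<mu>. (\<Sum>\<nu>\<in>UNIV. \<theta> $ \<mu> $ \<nu>) = 0"
  shows "\<theta> $ 1 $ 1 = 0" "\<theta> $ 2 $ 2 = 0" "\<theta> $ 3 $ 3 = 0" "\<theta> $ 4 $ 4 = 0"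
    "\<theta> $ 1 $ 4 = - \<theta> $ 1 $ 2 - \<theta> $ 1 $ 3" "\<theta> $ 2 $ 4 = \<theta> $ 1 $ 2 - \<theta> $ 2 $ 3"
    "\<theta> $ 3 $ 4 = \<theta> $ 1 $ 3 + \<theta> $ 2 $ 3" "\<theta> $ 2 $ 1 = - \<theta> $ 1 $ 2" "\<theta> $ 3 $ 1 = - \<theta> $ 1 $ 3"
    "\<theta> $ 3 $ 2 = - \<theta> $ 2 $ 3" "\<theta> $ 4 $ 1 = \<theta> $ 1 $ 2 + \<theta> $ 1 $ 3"
    "\<theta> $ 4 $ 2 = \<theta> $ 2 $ 3 - \<theta> $ 1 $ 2" "\<theta> $ 4 $ 3 = - \<theta> $ 1 $ 3 - \<theta> $ 2 $ 3"
proof -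
  note anti = assms(1)[rule_format]
  show diag: "\<theta> $ 1 $ 1 = 0" "\<theta> $ 2 $ 2 = 0" "\<theta> $ 3 $ 3 = 0" "\<theta> $ 4 $ 4 = 0"
    using anti[of 1 1] anti[of 2 2] anti[of 3 3] anti[of 4 4] by simp_all
  show lower: "\<theta> $ 2 $ 1 = - \<theta> $ 1 $ 2" "\<theta> $ 3 $ 1 = - \<theta> $ 1 $ 3" "\<theta> $ 3 $ 2 = - \<theta> $ 2 $ 3"
    by (rule anti)+
  show upper: "\<theta> $ 1 $ 4 = - \<theta> $ 1 $ 2 - \<theta> $ 1 $ 3" "\<theta> $ 2 $ 4 = \<theta> $ 1 $ 2 - \<theta> $ 2 $ 3"
    "\<theta> $ 3 $ 4 = \<theta> $ 1 $ 3 + \<theta> $ 2 $ 3"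
    using assms(2)[rule_format, of 1] assms(2)[rule_format, of 2] assms(2)[rule_format, of 3]
    by (simp_all add: sum_4 diag lower)
  show "\<theta> $ 4 $ 1 = \<theta> $ 1 $ 2 + \<theta> $ 1 $ 3" "\<theta> $ 4 $ 2 = \<theta> $ 2 $ 3 - \<theta> $ 1 $ 2"
    "\<theta> $ 4 $ 3 = - \<theta> $ 1 $ 3 - \<theta> $ 2 $ 3"
    using anti[of 4 1] anti[of 4 2] anti[of 4 3] upper by simp_all
qed

theorem proposition6p4:
  fixes \<theta> :: "real^4^4"
  assumes antisym: "\<forall>\<mu> \<nu>. \<theta> $ \<mu> $ \<nu> = - \<theta> $ \<nu> $ \<mu>"
    and rows: "\<forall>\<mu>. (\<Sum>\<nu>\<in>UNIV. \<theta> $ \<mu> $ \<nu>) = 0"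
    and cols: "\<forall>\<nu>. (\<Sum>\<mu>\<in>UNIV. \<theta> $ \<mu> $ \<nu>) = 0"
  shows "(compatible_quantisation \<theta> \<longleftrightarrow> \<theta>A \<theta> = \<theta>B \<theta> \<and> \<theta>B \<theta> = - (1/2) * \<theta>0 \<theta>)
    \<and> ((\<forall>\<mu> \<nu>. \<bar>\<theta> $ \<mu> $ \<nu>\<bar> < pi / 2) \<longrightarrow>
        (compatible \<theta> \<longleftrightarrow> \<theta>A \<theta> = \<theta>B \<theta> \<and> \<theta>B \<theta> = - (1/2) * \<theta>0 \<theta>))
    \<and> (\<theta>A \<theta> = \<theta>B \<theta> \<and> \<theta>B \<theta> = - (1/2) * \<theta>0 \<theta> \<longrightarrow>
        compatible \<theta> \<and>
        tw_sphere_eq \<theta> (star (ent_z (Phat \<theta>)))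
          (exp (\<i> / 2 * complex_of_real (\<theta>0 \<theta>)) *\<^sub>C ent_zt (Phat \<theta>)) \<and>
        tw_sphere_eq \<theta> (star (ent_w (Phat \<theta>)))
          (- (exp (- (\<i> / 2) * complex_of_real (\<theta>0 \<theta>)) *\<^sub>C ent_wt (Phat \<theta>))))"
proof -
  \<comment> \<open>For an antisymmetric matrix with zero row sums this says that
    \<open>sphere_wt\<close> lies in the kernel. The equations are homogeneous, so they pass between
    \<theta> and its nonzero multiples.\<close>
  define flat :: "real^4^4 \<Rightarrow> bool" where "flat \<eta> \<longleftrightarrow> \<eta> $ 1 $ 2 = 0 \<and> \<eta> $ 2 $ 3 = - \<eta> $ 1 $ 3" for \<eta>
  have scale: "\<forall>\<mu> \<nu>. (s *\<^sub>R \<theta>) $ \<mu> $ \<nu> = - (s *\<^sub>R \<theta>) $ \<nu> $ \<mu>"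
    "\<forall>\<mu>. (\<Sum>\<nu>\<in>UNIV. (s *\<^sub>R \<theta>) $ \<mu> $ \<nu>) = 0" for s
  proof -
    show "\<forall>\<mu> \<nu>. (s *\<^sub>R \<theta>) $ \<mu> $ \<nu> = - (s *\<^sub>R \<theta>) $ \<nu> $ \<mu>"
    proof (intro allI)
      show "(s *\<^sub>R \<theta>) $ \<mu> $ \<nu> = - (s *\<^sub>R \<theta>) $ \<nu> $ \<mu>" for \<mu> \<nu>
        using antisym[rule_format, of \<mu> \<nu>] by simp
    qed
  qed (use rows in \<open>simp flip: sum_distrib_left\<close>)
  note entries = deformation_matrix[OF antisym rows]
  have cond: "\<theta>A \<theta> = \<theta>B \<theta> \<and> \<theta>B \<theta> = - (1/2) * \<theta>0 \<theta> \<longleftrightarrow> flat \<theta>"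
    by (auto simp: \<theta>A_def \<theta>B_def \<theta>0_def flat_def entries)
  have trivial: "cocycle \<eta> sphere_wt b = 1" "cocycle \<eta> b sphere_wt = 1"
    if "flat \<eta>" "\<forall>\<mu> \<nu>. \<eta> $ \<mu> $ \<nu> = - \<eta> $ \<nu> $ \<mu>" "\<forall>\<mu>. (\<Sum>\<nu>\<in>UNIV. \<eta> $ \<mu> $ \<nu>) = 0" for \<eta> b
    using that(1)
    by (simp_all add: cocycle_def sphere_wt_def sum_4 axis_def flat_def deformation_matrix[OF that(2,3)]
        algebra_simps)
  have small: "flat \<eta>"
    if "compatible \<eta>" "\<forall>\<mu> \<nu>. \<bar>\<eta> $ \<mu> $ \<nu>\<bar> < pi / 2"
      "\<forall>\<mu> \<nu>. \<eta> $ \<mu> $ \<nu> = - \<eta> $ \<nu> $ \<mu>" "\<forall>\<mu>. (\<Sum>\<nu>\<in>UNIV. \<eta> $ \<mu> $ \<nu>) = 0" for \<eta>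
  proof -
    note e = deformation_matrix[OF that(3,4)]
    \<comment> \<open>These bounds put both exponents below, from the weights of z and w, strictly
      within 2 pi of zero. Together the two exponents determine the entries 12 and 34.\<close>
    have *: "\<bar>\<eta> $ 1 $ 2\<bar> < pi / 2" "\<bar>\<eta> $ 3 $ 4\<bar> < pi / 2"
      using that(2) by blast+
    have "exp (\<i> * complex_of_real (- 2 * \<eta> $ 1 $ 2 - 2 * \<eta> $ 3 $ 4)) = 1"
      using compatible_imp_cocycle[OF that(1), of 1 3]
      by (simp add: sphere_point_def cocycle_def sphere_wt_def sum_4 axis_def e algebra_simps)
    then have 1: "- 2 * \<eta> $ 1 $ 2 - 2 * \<eta> $ 3 $ 4 = 0"
      by (rule exp_ii_eq_1_imp_zero) (use * in linarith)
    have "exp (\<i> * complex_of_real (2 * \<eta> $ 1 $ 2 - 2 * \<eta> $ 3 $ 4)) = 1"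
      using compatible_imp_cocycle[OF that(1), of 2 3]
      by (simp add: sphere_point_def cocycle_def sphere_wt_def sum_4 axis_def e algebra_simps)
    then have "2 * \<eta> $ 1 $ 2 - 2 * \<eta> $ 3 $ 4 = 0"
      by (rule exp_ii_eq_1_imp_zero) (use * in linarith)
    with 1 show "flat \<eta>"
      by (simp add: flat_def e)
  qed
  have "flat \<theta>" if "compatible_quantisation \<theta>"
  proof -
    \<comment> \<open>The factor \<open>s\<close> shrinks every entry below 1, hence below pi / 2.
      Adding 1 in the denominator keeps it positive even when \<theta> is zero.\<close>
    define M where "M = (\<Sum>\<mu>\<in>UNIV. \<Sum>\<nu>\<in>UNIV. \<bar>\<theta> $ \<mu> $ \<nu>\<bar>)"
    define s where "s = 1 / (M + 1)"
    have bound: "\<bar>\<theta> $ \<mu> $ \<nu>\<bar> \<le> M" for \<mu> \<nu>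
    proof -
      have "\<bar>\<theta> $ \<mu> $ \<nu>\<bar> \<le> (\<Sum>\<nu>\<in>UNIV. \<bar>\<theta> $ \<mu> $ \<nu>\<bar>)"
        by (rule member_le_sum) auto
      also have "\<dots> \<le> M"
        unfolding M_def by (rule member_le_sum) (auto intro: sum_nonneg)
      finally show ?thesis .
    qed
    have "0 \<le> M"
      by (simp add: M_def sum_nonneg)
    then have "0 < s"
      by (simp add: s_def)
    have "\<bar>(s *\<^sub>R \<theta>) $ \<mu> $ \<nu>\<bar> < pi / 2" for \<mu> \<nu>
    proof -
      have "\<bar>(s *\<^sub>R \<theta>) $ \<mu> $ \<nu>\<bar> \<le> s * M"
        using bound \<open>0 < s\<close> by (simp add: abs_mult)
      also have "\<dots> < 1"
        using \<open>0 \<le> M\<close> by (simp add: s_def)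
      finally show ?thesis
        using pi_gt3 by linarith
    qed
    then have "flat (s *\<^sub>R \<theta>)"
      using that by (intro small[OF _ _ scale] allI) (simp_all only: compatible_quantisation_def)
    then have "s * \<theta> $ 1 $ 2 = 0" "s * \<theta> $ 2 $ 3 = s * - \<theta> $ 1 $ 3"
      by (simp_all add: flat_def)
    then show ?thesis
      using \<open>0 < s\<close> unfolding flat_def mult_cancel_left by simp
  qed
  moreover have "compatible_quantisation \<theta>" if "flat \<theta>"
    unfolding compatible_quantisation_def
  proof
    fix s
    have "flat (s *\<^sub>R \<theta>)"
      using that by (simp add: flat_def)
    then show "compatible (s *\<^sub>R \<theta>)"
      by (intro compatibleI(2) trivial scale)
  qed
  moreover have "compatible \<theta>" if "flat \<theta>"
    by (intro compatibleI(2) trivial that antisym rows)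
  moreover have "tw_sphere_eq \<theta> (star (ent_z (Phat \<theta>)))
          (exp (\<i> / 2 * complex_of_real (\<theta>0 \<theta>)) *\<^sub>C ent_zt (Phat \<theta>))
      \<and> tw_sphere_eq \<theta> (star (ent_w (Phat \<theta>)))
          (- (exp (- (\<i> / 2) * complex_of_real (\<theta>0 \<theta>)) *\<^sub>C ent_wt (Phat \<theta>)))" if "flat \<theta>"
  proof -
    have mem: "c *\<^sub>C f \<in> tw_sphere_ideal \<theta>" if "f \<in> sphere_rels Pgen" for c f
      unfolding compatibleI(1)[OF trivial[OF \<open>flat \<theta>\<close> antisym rows]]
      by (intro span_cscale span_base UnI1 that)
    let ?t = "\<theta> $ 1 $ 3"
    have e: "\<theta> $ 1 $ 4 = - ?t" "\<theta> $ 2 $ 3 = - ?t" "\<theta> $ 2 $ 4 = ?t" "\<theta>0 \<theta> = 4 * ?t"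
      using that by (simp_all add: flat_def entries \<theta>0_def)
    \<comment> \<open>The star conjugates the phase of \<open>Phat\<close>. With the prefactor
      \<open>exp (2 * \<i> * ?t)\<close> on zt, both terms carry the phase
      \<open>exp (\<i> * ?t)\<close>, leaving a multiple of a classical relation. For w the signs
      are reversed.\<close>
    have "star (ent_z (Phat \<theta>)) - exp (\<i> / 2 * complex_of_real (\<theta>0 \<theta>)) *\<^sub>C ent_zt (Phat \<theta>)
        = exp (\<i> * ?t) *\<^sub>C (Pgen 3 1 - Pgen 2 4)"
      by (simp add: ent_z_def ent_zt_def Phat_def star_cscale star_Pgen cscale_cscale e exp_cnj
          cscale_diff_right flip: exp_add)
    moreover have "star (ent_w (Phat \<theta>)) + exp (- (\<i> / 2) * complex_of_real (\<theta>0 \<theta>)) *\<^sub>C ent_wt (Phat \<theta>)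
        = exp (- \<i> * ?t) *\<^sub>C (Pgen 3 2 + Pgen 1 4)"
      by (simp add: ent_w_def ent_wt_def Phat_def star_cscale star_Pgen cscale_cscale e exp_cnj
          cscale_add_right flip: exp_add)
    moreover have "Pgen 3 1 - Pgen 2 4 \<in> sphere_rels Pgen" "Pgen 3 2 + Pgen 1 4 \<in> sphere_rels Pgen"
      by (simp_all add: sphere_rels_def ent_z_def ent_zt_def ent_w_def ent_wt_def star_Pgen)
    ultimately show ?thesis
      by (simp add: tw_sphere_eq_def mem)
  qed
  ultimately show ?thesis
    unfolding cond using small[OF _ _ antisym rows] by blast
qed

end
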